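(* Let $n\ge1$, let $(S_i,\mathbb{S}_i)$, $i=1,\ldots,n$, be measurable spaces, $S=\prod_{i=1}^n S_i$, $\mathbb{S}=\bigotimes_{i=1}^n\mathbb{S}_i$, and let $\mathbf{X}=(X_1,\ldots,X_n)\in S$ be a random vector with independent coordinates. Let $m\ge 1$ and, for each $i=1,\ldots,m$, let $\mathcal{A}_i$ be a finite or countable index set and $\{f_{i,\alpha}\}_{\alpha\in\mathcal{A}_i}$ a collection of non-negative real-valued $\mathbb{S}$-measurable functions on $S$ such that $f_{i,\alpha}$ depends on $K_{i,\alpha}\subseteq\{1,\ldots,n\}$. Then $$E\Big\{\sup\ \prod_{i=1}^m f_{i,\alpha_i}(\mathbf{X})\Big\}\le\prod_{i=1}^m E\Big\{\sup_{\alpha\in\mathcal{A}_i} f_{i,\alpha}(\mathbf{X})\Big\},$$ where the supremum on the left is over all $(\alpha_1,\ldots,\alpha_m)\in\mathcal{A}_1\times\cdots\times\mathcal{A}_m$ such that $K_{k,\alpha_k}\cap K_{l,\alpha_l}=\emptyset$ for all $k\ne l$.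
   Context: A function $f$ on $S$ depends on $K\subseteq\{1,\ldots,n\}$ if $f(\mathbf{x})=f(\mathbf{y})$ whenever $x_i=y_i$ for all $i\in K$. The sets $K_{i,\alpha}$ need not be distinct. Expectations take values in $[0,\infty]$, $0\cdot\infty=0$, and the supremum of an empty collection of non-negative quantities is $0$. *)

theory Defs
  imports "HOL-Probability.Probability"
begin

(* Two points are compared only within S (for product spaces: the extensional
   functions in space (Pi\<^sub>M I M)). *)
definition depends_on :: "('i \<Rightarrow> 'a) set \<Rightarrow> (('i \<Rightarrow> 'a) \<Rightarrow> 'b) \<Rightarrow> 'i set \<Rightarrow> bool" where
  "depends_on S f K \<longleftrightarrow> (\<forall>x\<in>S. \<forall>y\<in>S. (\<forall>i\<in>K. x i = y i) \<longrightarrow> f x = f y)"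

definition disjoint_choices ::
  "nat \<Rightarrow> (nat \<Rightarrow> 'b set) \<Rightarrow> (nat \<Rightarrow> 'b \<Rightarrow> nat set) \<Rightarrow> (nat \<Rightarrow> 'b) set" where
  "disjoint_choices m A K =
     {\<alpha> \<in> Pi\<^sub>E {1..m} A. \<forall>k\<in>{1..m}. \<forall>l\<in>{1..m}. k \<noteq> l \<longrightarrow> K k (\<alpha> k) \<inter> K l (\<alpha> l) = {}}"

end

theory Submission
  imports Defs
begin

text \<open>The inequality is a functional form of Reimer's theorem (the van den Berg--Kesten conjecture), and the
proof reduces it to a counting statement on the cube \<open>{0,1}\<^sup>I\<close>.

The counting statement, \<open>reimer_cube\<close>, says: if every vertex \<open>x\<close> of a set \<open>C\<close> has a set \<open>s x\<close> of
coordinates such that the values of \<open>x\<close> on \<open>s x\<close> force membership in \<open>A\<close> and the values off \<open>s x\<close>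
force membership in \<open>B\<close>, then \<open>C\<close> has at most as many points as there are points of \<open>A\<close> with antipode
in \<open>B\<close>. The argument is linear algebra. To every \<open>x\<close> belongs an integer vector (\<open>red_vec\<close>), a tensor
product of plane vectors, which is supported on the subcube of points that agree with \<open>x\<close> on
\<open>s x\<close>, hence on \<open>A\<close>. Its image (\<open>yellow_vec\<close>) under a fixed positive definite tensor power is
supported on the antipodes of the points that agree with \<open>x\<close> off \<open>s x\<close>, hence on antipodes of \<open>B\<close>. A
combination of the red vectors that vanishes at all points of \<open>A\<close> with antipode in \<open>B\<close> is
therefore orthogonal to its own image and must be zero (\<open>hex_form_bound\<close>). As the red
vectors are congruent modulo 2 to the distinct unit vectors at the \<open>x\<close>, they are linearly
independent (\<open>red_vec_independent\<close>), so there cannot be more of them than such points.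

Writing a product \<open>a * b\<close> as the area of a rectangle turns the counting statement into an
inequality for sums over the cube of suprema of products (\<open>reimer_cube_functional\<close>).

On a general product space, take two independent samples of each coordinate. Each vertex of the cube
selects one sample per coordinate, which maps the cube at random into the product space. All selections
have the same law, and opposite selections are independent. Averaging the inequality on the cube
gives the case of two families (\<open>reimer_functional_two\<close>), and induction gives the case of
\<open>m\<close> families. As this map is random, the coordinate spaces can be arbitrary.\<close>

section \<open>Sums over the cube and integer linear algebra\<close>

lemma sum_Pow_prod:
  fixes a :: "'i \<Rightarrow> bool \<Rightarrow> 'a::comm_semiring_1"
  assumes "finite I"
  shows "(\<Sum>z\<in>Pow I. \<Prod>i\<in>I. a i (i \<in> z)) = (\<Prod>i\<in>I. a i True + a i False)"
proof -
  have "(\<Prod>i\<in>I. a i (i \<in> z)) = (\<Prod>i\<in>z. a i True) * (\<Prod>i\<in>I-z. a i False)" if "z \<in> Pow I" for z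
    using prod.subset_diff[of z I "\<lambda>i. a i (i \<in> z)"] that assms by (auto simp: mult.commute)
  then show ?thesis
    using prod_add[OF assms, of "\<lambda>i. a i True" "\<lambda>i. a i False"] by simp
qed

lemma sum_Pow_insert:
  assumes "finite I" "a \<notin> I"
  shows "(\<Sum>z\<in>Pow (insert a I). h z) = (\<Sum>z\<in>Pow I. h z) + (\<Sum>z\<in>Pow I. h (insert a z))"
proof -
  have "inj_on (insert a) (Pow I)" using assms(2) by (auto simp: inj_on_def)
  moreover have "Pow I \<inter> insert a ` Pow I = {}" using assms(2) by auto
  ultimately show ?thesis
    using assms(1) by (simp add: Pow_insert sum.union_disjoint sum.reindex)
qed

text \<open>A homogeneous system with more unknowns than equations is solved nontrivially. The elimination
avoids division, so that the solution is found inside the domain (here used for the integers).\<close>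
lemma ex_nontrivial_kernel:
  fixes a :: "'x \<Rightarrow> 'e \<Rightarrow> 'r::idom"
  assumes "finite E" "finite X" "card E < card X"
  shows "\<exists>c. (\<exists>x\<in>X. c x \<noteq> 0) \<and> (\<forall>e\<in>E. (\<Sum>x\<in>X. c x * a x e) = 0)"
  using assms
proof (induction E arbitrary: X a rule: finite_induct)
  case empty
  then show ?case by (intro exI[of _ "\<lambda>_. 1"]) (auto simp: card_gt_0_iff)
next
  case (insert e E)
  show ?case
  proof (cases "\<forall>x\<in>X. a x e = 0")
    case True
    have "card E < card X" using insert.hyps insert.prems(2) by simp
    from insert.IH[OF insert.prems(1) this, of a] True show ?thesis by auto
  next
    case False
    then obtain y where y: "y \<in> X" "a y e \<noteq> 0" by auto
    let ?X = "X - {y}"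
    have "card E < card ?X" using insert y by simp
    from insert.IH[OF _ this, of "\<lambda>x d. a y e * a x d - a x e * a y d"] insert.prems
    obtain c where c: "\<exists>x\<in>?X. c x \<noteq> 0"
      "\<And>d. d \<in> E \<Longrightarrow> (\<Sum>x\<in>?X. c x * (a y e * a x d - a x e * a y d)) = 0" by auto
    \<comment> \<open>Elimination of the unknown at \<open>y\<close> by the equation at \<open>e\<close>, scaled by the pivot \<open>a y e\<close>.\<close>
    define c' where "c' x = (if x = y then - (\<Sum>x\<in>?X. c x * a x e) else a y e * c x)" for x
    have split: "(\<Sum>x\<in>X. c' x * a x d) = (\<Sum>x\<in>?X. c x * (a y e * a x d - a x e * a y d))" for d
      using insert.prems(1) y(1)
      by (simp add: sum.remove[of X y] c'_def sum_distrib_left sum_distrib_right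
          sum_subtractf sum_negf algebra_simps)
    have "(\<Sum>x\<in>X. c' x * a x d) = 0" if "d \<in> insert e E" for d
      using that c(2) unfolding split by (auto simp: mult.commute)
    moreover have "\<exists>x\<in>X. c' x \<noteq> 0" using c(1) y(2) by (auto simp: c'_def)
    ultimately show ?thesis by blast
  qed
qed

section \<open>Reimer's theorem on the uniform cube\<close>

text \<open>The form on functions on the cube whose matrix is the tensor power of the Gram matrix of a hexagonal
lattice basis, \<open>(2, -1; -1, 2)\<close>. Vertices of the cube \<open>{0,1}\<^sup>I\<close> are encoded
as subsets of \<open>I\<close>.\<close>
definition hex_form :: "'i set \<Rightarrow> 'i set \<Rightarrow> 'i set \<Rightarrow> int" where
  "hex_form I z z' = (\<Prod>i\<in>I. if (i \<in> z) = (i \<in> z') then 2 else -1)"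

text \<open>A tensor product of vectors of the plane, one for each coordinate \<open>i\<close>. Relative to the
basis (unit vector at the bit of \<open>x\<close>, unit vector at the other bit), the factor is
\<open>(1, 0)\<close> for \<open>i \<in> s\<close> and \<open>(1, 2)\<close> otherwise; both are
\<open>(1, 0)\<close> modulo 2.\<close>
definition red_vec :: "'i set \<Rightarrow> 'i set \<Rightarrow> 'i set \<Rightarrow> 'i set \<Rightarrow> int" where
  "red_vec I s x z = (\<Prod>i\<in>I. if (i \<in> z) = (i \<in> x) then 1 else if i \<in> s then 0 else 2)"

text \<open>The image of \<open>red_vec\<close> under the matrix of \<open>hex_form\<close>: in the same local basis
the factor is \<open>(2, -1)\<close> for \<open>i \<in> s\<close> and \<open>(0, 3)\<close> otherwise. The
zero in \<open>(0, 3)\<close> is what the choice of \<open>(1, 2)\<close> above is made for.\<close>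
definition yellow_vec :: "'i set \<Rightarrow> 'i set \<Rightarrow> 'i set \<Rightarrow> 'i set \<Rightarrow> int" where
  "yellow_vec I s x z =
     (\<Prod>i\<in>I. if (i \<in> z) = (i \<in> x) then if i \<in> s then 2 else 0 else if i \<in> s then -1 else 3)"

text \<open>The one-coordinate matrix is the identity plus \<open>(1, -1; -1, 1)\<close>, that is, its form at
\<open>(u, v)\<close> is \<open>u\<^sup>2 + v\<^sup>2 + (u - v)\<^sup>2\<close>. Splitting off one coordinate therefore
expresses the form by three values of the form in one dimension less.\<close>
lemma hex_form_bound:
  assumes "finite I"
  shows "(\<Sum>z\<in>Pow I. (U z)\<^sup>2) \<le> (\<Sum>z\<in>Pow I. \<Sum>z'\<in>Pow I. U z * hex_form I z z' * U z')"
  using assms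
proof (induction I arbitrary: U rule: finite_induct)
  case empty
  then show ?case by (simp add: hex_form_def power2_eq_square)
next
  case (insert a I)
  let ?q = "\<lambda>U V. \<Sum>z\<in>Pow I. \<Sum>z'\<in>Pow I. U z * hex_form I z z' * V z'"
  let ?V = "\<lambda>z. U (insert a z)"
  have ne: "a \<notin> z" if "z \<in> Pow I" for z using that insert.hyps by auto
  have form: "hex_form (insert a I) z z' = 2 * hex_form I z z'"
    "hex_form (insert a I) (insert a z) z' = - hex_form I z z'"
    "hex_form (insert a I) z (insert a z') = - hex_form I z z'"
    "hex_form (insert a I) (insert a z) (insert a z') = 2 * hex_form I z z'"
    if "z \<in> Pow I" "z' \<in> Pow I" for z z'
    using that ne insert.hyps unfolding hex_form_def
    by (auto intro!: prod.cong)
  have "(\<Sum>z\<in>Pow (insert a I). \<Sum>z'\<in>Pow (insert a I). U z * hex_form (insert a I) z z' * U z')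
      = (\<Sum>z\<in>Pow I. \<Sum>z'\<in>Pow I. U z * hex_form (insert a I) z z' * U z'
          + U z * hex_form (insert a I) z (insert a z') * ?V z'
          + ?V z * hex_form (insert a I) (insert a z) z' * U z'
          + ?V z * hex_form (insert a I) (insert a z) (insert a z') * ?V z')"
    using insert.hyps by (simp add: sum_Pow_insert sum.distrib del: Pow_insert)
  also have "\<dots> = (\<Sum>z\<in>Pow I. \<Sum>z'\<in>Pow I. U z * hex_form I z z' * U z' + ?V z * hex_form I z z' * ?V z'
          + (U z - ?V z) * hex_form I z z' * (U z' - ?V z'))"
    by (intro sum.cong refl) (simp only: form, simp add: algebra_simps)
  also have "\<dots> = ?q U U + ?q ?V ?V + ?q (\<lambda>z. U z - ?V z) (\<lambda>z. U z - ?V z)"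
    by (simp only: sum.distrib)
  also have "\<dots> \<ge> (\<Sum>z\<in>Pow I. (U z)\<^sup>2) + (\<Sum>z\<in>Pow I. (?V z)\<^sup>2)"
    using insert.IH[of U] insert.IH[of ?V] insert.IH[of "\<lambda>z. U z - ?V z"]
      sum_nonneg[of "Pow I" "\<lambda>z. (U z - ?V z)\<^sup>2"] by simp
  finally show ?case using insert.hyps by (simp add: sum_Pow_insert del: Pow_insert)
qed

lemma hex_form_red_vec:
  assumes "finite I"
  shows "(\<Sum>z'\<in>Pow I. hex_form I z z' * red_vec I s x z') = yellow_vec I s x z"
proof -
  let ?a = "\<lambda>i b. (if (i \<in> z) = b then 2 else -1) * (if b = (i \<in> x) then 1 else if i \<in> s then 0 else 2) :: int"
  have "(\<Sum>z'\<in>Pow I. hex_form I z z' * red_vec I s x z') = (\<Prod>i\<in>I. ?a i True + ?a i False)"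
    unfolding hex_form_def red_vec_def prod.distrib[symmetric]
    by (rule sum_Pow_prod[OF assms, of ?a])
  also have "\<dots> = yellow_vec I s x z"
    unfolding yellow_vec_def by (intro prod.cong) auto
  finally show ?thesis .
qed

lemma red_vec_support:
  assumes "finite I" "red_vec I s x z \<noteq> 0" "i \<in> I" "i \<in> s"
  shows "i \<in> z \<longleftrightarrow> i \<in> x"
  using assms unfolding red_vec_def by (auto split: if_splits)

lemma yellow_vec_support:
  assumes "finite I" "yellow_vec I s x z \<noteq> 0" "i \<in> I" "i \<notin> s"
  shows "i \<in> z \<longleftrightarrow> i \<notin> x"
  using assms unfolding yellow_vec_def by (auto split: if_splits)

lemma red_vec_mod_2:
  assumes "finite I" "x \<subseteq> I" "z \<subseteq> I"
  shows "even (red_vec I s x z - (if z = x then 1 else 0))"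
proof (cases "z = x")
  case True
  then show ?thesis by (simp add: red_vec_def)
next
  case False
  then obtain i where i: "i \<in> I" "(i \<in> z) \<noteq> (i \<in> x)" using assms by blast
  have "even (red_vec I s x z)"
    unfolding red_vec_def
    by (rule dvd_trans[OF _ dvd_prodI[OF assms(1) i(1)]]) (use i in auto)
  with False show ?thesis by simp
qed

text \<open>By the congruence \<open>red_vec_mod_2\<close> the matrix with rows \<open>red_vec I (s x) x\<close> is the identity
modulo 2, whatever the sets \<open>s x\<close> are, so it has odd determinant on every set of vertices. The
determinant is avoided by descent: the coefficients of a linear relation are all even, and halving
them gives another relation, so that they are divisible by every power of 2.\<close>
lemma red_vec_independent:
  assumes I: "finite I" and C: "C \<subseteq> Pow I"
    and ker: "\<And>z. z \<in> C \<Longrightarrow> (\<Sum>x\<in>C. c x * red_vec I (s x) x z) = 0"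
    and x: "x \<in> C"
  shows "c x = 0"
proof -
  have fin: "finite C" using C I finite_subset by blast
  have "\<forall>x\<in>C. 2 ^ k dvd c x"
    if "\<And>z. z \<in> C \<Longrightarrow> (\<Sum>x\<in>C. c x * red_vec I (s x) x z) = 0" for k c
    using that
  proof (induction k arbitrary: c)
    case 0
    then show ?case by simp
  next
    case (Suc k)
    have ev: "even (c z)" if z: "z \<in> C" for z
    proof -
      have "even (c x * red_vec I (s x) x z - c x * (if z = x then 1 else 0))" if "x \<in> C" for x
        unfolding right_diff_distrib[symmetric]
        using red_vec_mod_2[OF I, of x z "s x"] that z C by (intro dvd_mult) blast
      then have "even (\<Sum>x\<in>C. c x * red_vec I (s x) x z - c x * (if z = x then 1 else 0))"
        by (rule dvd_sum)
      moreover have "(\<Sum>x\<in>C. c x * (if z = x then 1 else 0)) = c z"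
        using fin z by (simp add: if_distrib cong: if_cong)
      ultimately show ?thesis using Suc.prems[OF z] by (simp add: sum_subtractf)
    qed
    have "2 * (\<Sum>x\<in>C. c x div 2 * red_vec I (s x) x z) = 0" if "z \<in> C" for z
      unfolding Suc.prems[OF that, symmetric] sum_distrib_left
      by (intro sum.cong) (use ev in auto)
    then have "\<forall>x\<in>C. 2 ^ k dvd c x div 2" by (intro Suc.IH) simp
    then show ?case
      using ev by (force elim!: evenE)
  qed
  from this[OF ker] x have dv: "2 ^ k dvd c x" for k by blast
  show ?thesis
  proof (rule ccontr)
    assume "c x \<noteq> 0"
    with dv[of "nat \<bar>c x\<bar>"] have "2 ^ nat \<bar>c x\<bar> \<le> \<bar>c x\<bar>"
      using zdvd_imp_le[of "2 ^ nat \<bar>c x\<bar>" "\<bar>c x\<bar>"] by auto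
    moreover have "int (nat \<bar>c x\<bar>) < 2 ^ nat \<bar>c x\<bar>" by (rule of_nat_less_two_power)
    ultimately show False by simp
  qed
qed

text \<open>Reimer's theorem on the uniform cube. Each \<open>x \<in> C\<close> comes with a set of coordinates \<open>s x\<close>
that certifies \<open>x \<in> A\<close> while the complementary coordinates certify \<open>x \<in> B\<close>. If there were
more such \<open>x\<close> than points in \<open>A\<close> whose antipode is in \<open>B\<close>, some nontrivial integer
combination \<open>U\<close> of the red vectors would vanish at all these points. As \<open>U\<close> lives on \<open>A\<close>
and its image under the matrix of \<open>hex_form\<close>, a combination of yellow vectors, lives on the
antipodes of \<open>B\<close>, the form vanishes at \<open>U\<close>. Positivity gives \<open>U = 0\<close>, against the
independence of the red vectors.\<close>
lemma reimer_cube: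
  assumes I: "finite I" and C: "C \<subseteq> Pow I"
    and A: "\<And>x z. x \<in> C \<Longrightarrow> z \<subseteq> I \<Longrightarrow> z \<inter> s x = x \<inter> s x \<Longrightarrow> z \<in> A"
    and B: "\<And>x z. x \<in> C \<Longrightarrow> z \<subseteq> I \<Longrightarrow> z - s x = x - s x \<Longrightarrow> z \<in> B"
  shows "card C \<le> card {z \<in> Pow I. z \<in> A \<and> I - z \<in> B}"
proof (rule ccontr)
  let ?E = "{z \<in> Pow I. z \<in> A \<and> I - z \<in> B}"
  assume "\<not> card C \<le> card ?E"
  moreover have "finite C" using C I finite_subset by blast
  ultimately obtain c where c: "\<exists>x\<in>C. c x \<noteq> 0"
    and E: "\<And>z. z \<in> ?E \<Longrightarrow> (\<Sum>x\<in>C. c x * red_vec I (s x) x z) = 0"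
    using ex_nontrivial_kernel[of ?E C "\<lambda>x z. red_vec I (s x) x z"] I by auto
  define U where "U z = (\<Sum>x\<in>C. c x * red_vec I (s x) x z)" for z
  define V where "V z = (\<Sum>x\<in>C. c x * yellow_vec I (s x) x z)" for z
  have V: "V z = (\<Sum>z'\<in>Pow I. hex_form I z z' * U z')" for z
    unfolding U_def V_def hex_form_red_vec[OF I, symmetric] sum_distrib_left
    by (subst sum.swap) (simp add: mult_ac)
  \<comment> \<open>Off the points counted on the right, one of the two factors lies outside its support.\<close>
  have UV: "U z * V z = 0" if z: "z \<in> Pow I" for z
  proof -
    consider "z \<in> ?E" | "z \<notin> A" | "I - z \<notin> B" using z by auto
    then show ?thesis
    proof cases
      case 1
      then show ?thesis using E by (simp add: U_def)
    next
      case 2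
      have "red_vec I (s x) x z = 0" if "x \<in> C" for x
      proof (rule ccontr)
        assume "red_vec I (s x) x z \<noteq> 0"
        from red_vec_support[OF I this] have "z \<inter> s x = x \<inter> s x" using z that C by blast
        with A[OF that] z 2 show False by auto
      qed
      then show ?thesis by (simp add: U_def)
    next
      case 3
      have "yellow_vec I (s x) x z = 0" if "x \<in> C" for x
      proof (rule ccontr)
        assume "yellow_vec I (s x) x z \<noteq> 0"
        from yellow_vec_support[OF I this] have "(I - z) - s x = x - s x" using z that C by blast
        with B[OF that, of "I - z"] 3 show False by auto
      qed
      then show ?thesis by (simp add: V_def)
    qed
  qed
  have "(\<Sum>z\<in>Pow I. (U z)\<^sup>2) \<le> (\<Sum>z\<in>Pow I. U z * V z)"
    using hex_form_bound[OF I, of U] by (simp add: V sum_distrib_left mult.assoc)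
  also have "\<dots> = 0" using UV by (intro sum.neutral) blast
  finally have "(\<Sum>z\<in>Pow I. (U z)\<^sup>2) = 0"
    by (intro antisym sum_nonneg) auto
  then have "U z = 0" if "z \<in> C" for z
    using that C I by (subst (asm) sum_nonneg_eq_0_iff) auto
  with red_vec_independent[OF I C, of c s] c show False unfolding U_def by blast
qed



section \<open>From events to functions on the cube\<close>

text \<open>The half-open interval from 0 to \<open>a\<close>, unbounded when \<open>a\<close> is infinite. Unlike a real
interval it makes sense for every extended value, and its strict upper bound turns suprema into
unions.\<close>
definition below :: "ennreal \<Rightarrow> real set" where
  "below a = {t. 0 \<le> t \<and> ennreal t < a}"

lemma below_borel [measurable]: "below a \<in> sets borel"
  unfolding below_def by measurable

lemma emeasure_below: "emeasure lborel (below a) = a"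
proof (cases a)
  case (real r)
  then have "below a = {0..<r}"
    by (auto simp: below_def ennreal_less_iff)
  then show ?thesis using real by simp
next
  case top
  have "(SUP n::nat. ennreal (real n)) = \<top>"
    using ennreal_SUP_of_nat_eq_top by (simp add: ennreal_of_nat_eq_real_of_nat)
  moreover have "ennreal (real n) \<le> emeasure lborel (below a)" for n
  proof -
    have "emeasure lborel {0..<real n} \<le> emeasure lborel (below a)"
      using top by (intro emeasure_mono) (auto simp: below_def)
    then show ?thesis by simp
  qed
  ultimately show ?thesis using top
    by (metis SUP_least top.extremum_unique)
qed

lemma below_SUP: "below (SUP x\<in>X. h x) = (\<Union>x\<in>X. below (h x))"
  by (auto simp: below_def less_SUP_iff)

lemma emeasure_below_Times: "emeasure (lborel \<Otimes>\<^sub>M lborel) (below a \<times> below b) = a * b"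
  by (simp add: lborel.emeasure_pair_measure_Times emeasure_below)

text \<open>Layer cake in two variables: \<open>a * b\<close> is the area of \<open>below a \<times> below b\<close>. The area of the union
of the rectangles of all disjoint pairs dominates the supremum of their areas, and at a fixed point
\<open>(t, u)\<close> of the plane the claim becomes the counting statement \<open>reimer_cube\<close> for the level sets of
the two suprema.\<close>
lemma reimer_cube_functional:
  fixes F :: "'a \<Rightarrow> 'i set \<Rightarrow> ennreal" and G :: "'b \<Rightarrow> 'i set \<Rightarrow> ennreal"
  assumes I: "finite I" and cnt: "countable A" "countable B"
    and F: "\<And>\<alpha> z z'. \<alpha> \<in> A \<Longrightarrow> z \<subseteq> I \<Longrightarrow> z' \<subseteq> I \<Longrightarrow> z \<inter> K \<alpha> = z' \<inter> K \<alpha> \<Longrightarrow> F \<alpha> z = F \<alpha> z'"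
    and G: "\<And>\<beta> z z'. \<beta> \<in> B \<Longrightarrow> z \<subseteq> I \<Longrightarrow> z' \<subseteq> I \<Longrightarrow> z \<inter> L \<beta> = z' \<inter> L \<beta> \<Longrightarrow> G \<beta> z = G \<beta> z'"
  shows "(\<Sum>z\<in>Pow I. SUP (\<alpha>, \<beta>)\<in>{(\<alpha>, \<beta>) \<in> A \<times> B. K \<alpha> \<inter> L \<beta> = {}}. F \<alpha> z * G \<beta> z)
       \<le> (\<Sum>z\<in>Pow I. (SUP \<alpha>\<in>A. F \<alpha> z) * (SUP \<beta>\<in>B. G \<beta> (I - z)))"
proof -
  let ?D = "{(\<alpha>, \<beta>) \<in> A \<times> B. K \<alpha> \<inter> L \<beta> = {}}"
  let ?N = "lborel \<Otimes>\<^sub>M lborel :: (real \<times> real) measure"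
  define R where "R z = (\<Union>(\<alpha>, \<beta>)\<in>?D. below (F \<alpha> z) \<times> below (G \<beta> z))" for z
  define Q where "Q z = below (SUP \<alpha>\<in>A. F \<alpha> z) \<times> below (SUP \<beta>\<in>B. G \<beta> (I - z))" for z
  have "countable ?D" using cnt by (auto intro: countable_subset[of _ "A \<times> B"])
  then have R_sets [measurable]: "R z \<in> sets ?N" for z
    unfolding R_def by (intro sets.countable_UN') auto
  have Q_sets [measurable]: "Q z \<in> sets ?N" for z
    unfolding Q_def by auto
  \<comment> \<open>The certificate of a vertex is the set \<open>K \<alpha>\<close> of some pair whose rectangle contains the point; the disjoint set \<open>L \<beta>\<close> lies in its complement.\<close>
  have count: "card {z \<in> Pow I. p \<in> R z} \<le> card {z \<in> Pow I. p \<in> Q z}" for p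
  proof -
    obtain t u where p: "p = (t, u)" by fastforce
    let ?C = "{z \<in> Pow I. p \<in> R z}"
    define wit where "wit z q \<longleftrightarrow> q \<in> ?D \<and> t \<in> below (F (fst q) z) \<and> u \<in> below (G (snd q) z)" for z q
    have "\<forall>z\<in>?C. \<exists>q. wit z q" unfolding wit_def R_def p by fastforce
    then obtain q where q: "\<And>z. z \<in> ?C \<Longrightarrow> wit z (q z)" by metis
    let ?A = "{z. t \<in> below (SUP \<alpha>\<in>A. F \<alpha> z)}" and ?B = "{z. u \<in> below (SUP \<beta>\<in>B. G \<beta> z)}"
    have "card ?C \<le> card {z \<in> Pow I. z \<in> ?A \<and> I - z \<in> ?B}"
    proof (rule reimer_cube[OF I, where s = "\<lambda>x. K (fst (q x))"])
      fix x z
      assume x: "x \<in> ?C" and z: "z \<subseteq> I"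
      have w: "fst (q x) \<in> A" "snd (q x) \<in> B" "K (fst (q x)) \<inter> L (snd (q x)) = {}"
        "t \<in> below (F (fst (q x)) x)" "u \<in> below (G (snd (q x)) x)"
        using q[OF x] by (auto simp: wit_def)
      {
        assume "z \<inter> K (fst (q x)) = x \<inter> K (fst (q x))"
        then have "F (fst (q x)) z = F (fst (q x)) x"
          using w z x by (intro F) auto
        then show "z \<in> ?A" using w by (auto simp: below_SUP intro!: bexI[of _ "fst (q x)"])
      next
        assume "z - K (fst (q x)) = x - K (fst (q x))"
        then have "G (snd (q x)) z = G (snd (q x)) x"
          using w z x by (intro G) auto
        then show "z \<in> ?B" using w by (auto simp: below_SUP intro!: bexI[of _ "snd (q x)"])
      }
    qed auto
    then show ?thesis by (simp add: p Q_def)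
  qed
  have sum_ind: "(\<Sum>z\<in>Pow I. emeasure ?N (W z)) = (\<integral>\<^sup>+p. of_nat (card {z \<in> Pow I. p \<in> W z}) \<partial>?N)"
    if "\<And>z. W z \<in> sets ?N" for W
  proof -
    have "(\<Sum>z\<in>Pow I. indicator (W z) p) = (of_nat (card {z \<in> Pow I. p \<in> W z}) :: ennreal)" for p
      using I by (simp add: indicator_def sum.If_cases Int_def)
    moreover have "(\<Sum>z\<in>Pow I. emeasure ?N (W z)) = (\<integral>\<^sup>+p. (\<Sum>z\<in>Pow I. indicator (W z) p) \<partial>?N)"
      using that by (subst nn_integral_sum) auto
    ultimately show ?thesis by simp
  qed
  have "(\<Sum>z\<in>Pow I. SUP (\<alpha>, \<beta>)\<in>?D. F \<alpha> z * G \<beta> z) \<le> (\<Sum>z\<in>Pow I. emeasure ?N (R z))"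
  proof (intro sum_mono SUP_least)
    fix z q assume "q \<in> ?D"
    moreover obtain \<alpha> \<beta> where "q = (\<alpha>, \<beta>)" by fastforce
    ultimately have "below (F \<alpha> z) \<times> below (G \<beta> z) \<subseteq> R z" and q: "q = (\<alpha>, \<beta>)"
      unfolding R_def by blast+
    from emeasure_mono[OF this(1) R_sets]
    show "(case q of (\<alpha>, \<beta>) \<Rightarrow> F \<alpha> z * G \<beta> z) \<le> emeasure ?N (R z)"
      by (simp add: q emeasure_below_Times)
  qed
  also have "\<dots> \<le> (\<Sum>z\<in>Pow I. emeasure ?N (Q z))"
    unfolding sum_ind[OF R_sets] sum_ind[OF Q_sets]
    by (intro nn_integral_mono of_nat_mono count)
  also have "\<dots> = (\<Sum>z\<in>Pow I. (SUP \<alpha>\<in>A. F \<alpha> z) * (SUP \<beta>\<in>B. G \<beta> (I - z)))"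
    by (simp add: Q_def emeasure_below_Times)
  finally show ?thesis .
qed

section \<open>Two independent copies of a product space\<close>

lemma depends_onD:
  assumes "depends_on S f K" "x \<in> S" "y \<in> S" "\<And>i. i \<in> K \<Longrightarrow> x i = y i"
  shows "f x = f y"
  using assms unfolding depends_on_def by blast

text \<open>A sample \<open>\<omega>\<close> consists of two independent copies of each coordinate, labelled by a Boolean. The set
\<open>z\<close> selects one of the two copies in each coordinate, so that \<open>mix I z \<omega>\<close> and
\<open>mix I (I - z) \<omega>\<close> share no copy.\<close>
definition mix :: "'i set \<Rightarrow> 'i set \<Rightarrow> ('i \<times> bool \<Rightarrow> 'a) \<Rightarrow> 'i \<Rightarrow> 'a" where
  "mix I z \<omega> = (\<lambda>i\<in>I. \<omega> (i, i \<in> z))"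

lemma mix_cong:
  assumes "z \<inter> K = z' \<inter> K" "i \<in> K"
  shows "mix I z \<omega> i = mix I z' \<omega> i"
proof -
  have "i \<in> z \<longleftrightarrow> i \<in> z'" using assms by blast
  then show ?thesis by (simp add: mix_def)
qed

lemma distr_mix:
  assumes "\<And>i. i \<in> I \<Longrightarrow> prob_space (M i)"
  shows "distr (Pi\<^sub>M (I \<times> UNIV) (\<lambda>p. M (fst p))) (Pi\<^sub>M I M) (mix I z) = Pi\<^sub>M I M"
  using distr_PiM_reindex[of "I \<times> UNIV" "\<lambda>p. M (fst p)" "\<lambda>i. (i, i \<in> z)" I] assms
  by (auto simp: mix_def[abs_def] inj_on_def)

lemma measurable_mix [measurable]:
  "mix I z \<in> measurable (Pi\<^sub>M (I \<times> UNIV) (\<lambda>p. M (fst p))) (Pi\<^sub>M I M)"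
  unfolding mix_def
  by (intro measurable_restrict measurable_component_singleton[of "(_, _)" _ "\<lambda>p. M (fst p)", simplified]) auto

lemma nn_integral_mix:
  assumes "\<And>i. i \<in> I \<Longrightarrow> prob_space (M i)" and "h \<in> borel_measurable (Pi\<^sub>M I M)"
  shows "(\<integral>\<^sup>+\<omega>. h (mix I z \<omega>) \<partial>Pi\<^sub>M (I \<times> UNIV) (\<lambda>p. M (fst p))) = (\<integral>\<^sup>+x. h x \<partial>Pi\<^sub>M I M)"
proof -
  let ?N = "Pi\<^sub>M (I \<times> UNIV) (\<lambda>p. M (fst p))"
  have "distr ?N (Pi\<^sub>M I M) (mix I z) = Pi\<^sub>M I M"
    using assms(1) by (rule distr_mix)
  then have "(\<integral>\<^sup>+x. h x \<partial>Pi\<^sub>M I M) = (\<integral>\<^sup>+x. h x \<partial>distr ?N (Pi\<^sub>M I M) (mix I z))"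
    by (rule arg_cong[symmetric])
  also have "\<dots> = (\<integral>\<^sup>+\<omega>. h (mix I z \<omega>) \<partial>?N)"
    by (rule nn_integral_distr[OF measurable_mix]) (simp only: measurable_distr_eq1 assms(2))
  finally show ?thesis ..
qed

lemma (in prob_space) indep_var_nn_integral:
  fixes X Y :: "'a \<Rightarrow> ennreal"
  assumes "indep_var borel X borel Y"
  shows "(\<integral>\<^sup>+\<omega>. X \<omega> * Y \<omega> \<partial>M) = (\<integral>\<^sup>+\<omega>. X \<omega> \<partial>M) * (\<integral>\<^sup>+\<omega>. Y \<omega> \<partial>M)"
proof -
  have "indep_vars (\<lambda>_. borel) (case_bool X Y) UNIV"
    using assms unfolding indep_var_def by (simp add: case_bool_if if_distrib cong: if_cong)
  from indep_vars_nn_integral[OF _ this] show ?thesis by (simp add: UNIV_bool mult.commute)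
qed

lemma indep_vars_PiM_coordinates:
  assumes M: "\<And>i. i \<in> J \<Longrightarrow> prob_space (M i)"
  shows "prob_space.indep_vars (Pi\<^sub>M J M) M (\<lambda>i \<omega>. \<omega> i) J"
proof -
  interpret prob_space "Pi\<^sub>M J M" using M by (rule prob_space_PiM)
  show ?thesis
  proof (cases "J = {}")
    case True
    with prob_space_axioms show ?thesis
      by (simp add: prob_space.indep_vars_def prob_space.indep_sets_def)
  next
    case False
    have "distr (Pi\<^sub>M J M) (Pi\<^sub>M J M) (\<lambda>\<omega>. \<lambda>i\<in>J. \<omega> i) = distr (Pi\<^sub>M J M) (Pi\<^sub>M J M) (\<lambda>\<omega>. \<omega>)"
      by (intro distr_cong) (auto simp: space_PiM)
    also have "\<dots> = Pi\<^sub>M J (\<lambda>i. distr (Pi\<^sub>M J M) (M i) (\<lambda>\<omega>. \<omega> i))"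
      unfolding distr_id by (intro PiM_cong refl) (simp add: distr_PiM_component M)
    finally show ?thesis
      by (subst indep_vars_iff_distr_eq_PiM'[OF False]) auto
  qed
qed

lemma nn_integral_mix_mult:
  assumes M: "\<And>i. i \<in> I \<Longrightarrow> prob_space (M i)"
    and F: "F \<in> borel_measurable (Pi\<^sub>M I M)"
    and G: "G \<in> borel_measurable (Pi\<^sub>M I M)"
  shows "(\<integral>\<^sup>+\<omega>. F (mix I z \<omega>) * G (mix I (I - z) \<omega>) \<partial>Pi\<^sub>M (I \<times> UNIV) (\<lambda>p. M (fst p)))
      = (\<integral>\<^sup>+x. F x \<partial>Pi\<^sub>M I M) * (\<integral>\<^sup>+x. G x \<partial>Pi\<^sub>M I M)"
proof -
  let ?M = "\<lambda>p. M (fst p)" and ?J = "I \<times> (UNIV :: bool set)"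
  let ?N = "Pi\<^sub>M ?J ?M"
  interpret N: prob_space ?N using M by (intro prob_space_PiM) auto
  \<comment> \<open>The labelled coordinates that are read off by the selection \<open>z\<close>.\<close>
  define a where "a z = (\<lambda>i. (i, i \<in> z)) ` I" for z
  have meas: "(\<lambda>\<eta>. mix I z \<eta>) \<in> measurable (Pi\<^sub>M (a z) ?M) (Pi\<^sub>M I M)" for z
    unfolding mix_def a_def
    by (intro measurable_restrict measurable_component_singleton[of "(_, _)" _ "\<lambda>p. M (fst p)", simplified]) auto
  have restr: "mix I z (restrict \<omega> (a z)) = mix I z \<omega>" for z \<omega>
    by (auto simp: mix_def a_def restrict_def fun_eq_iff)
  have "N.indep_vars ?M (\<lambda>p \<omega>. \<omega> p) ?J"
    using M by (intro indep_vars_PiM_coordinates) auto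
  then have "N.indep_var (Pi\<^sub>M (a z) ?M) (\<lambda>\<omega>. restrict \<omega> (a z)) (Pi\<^sub>M (a (I - z)) ?M) (\<lambda>\<omega>. restrict \<omega> (a (I - z)))"
    by (rule N.indep_var_restrict[where X = "\<lambda>p \<omega>. \<omega> p", simplified]) (auto simp: a_def)
  then have "N.indep_var borel ((\<lambda>\<eta>. F (mix I z \<eta>)) \<circ> (\<lambda>\<omega>. restrict \<omega> (a z)))
       borel ((\<lambda>\<eta>. G (mix I (I - z) \<eta>)) \<circ> (\<lambda>\<omega>. restrict \<omega> (a (I - z))))"
    by (rule N.indep_var_compose) (rule measurable_compose[OF meas F], rule measurable_compose[OF meas G])
  then have "N.indep_var borel (\<lambda>\<omega>. F (mix I z \<omega>)) borel (\<lambda>\<omega>. G (mix I (I - z) \<omega>))"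
    by (simp only: comp_def restr)
  note N.indep_var_nn_integral[OF this]
  also have "(\<integral>\<^sup>+\<omega>. F (mix I z \<omega>) \<partial>?N) = (\<integral>\<^sup>+x. F x \<partial>Pi\<^sub>M I M)"
    by (rule nn_integral_mix[OF M F])
  also have "(\<integral>\<^sup>+\<omega>. G (mix I (I - z) \<omega>) \<partial>?N) = (\<integral>\<^sup>+x. G x \<partial>Pi\<^sub>M I M)"
    by (rule nn_integral_mix[OF M G])
  finally show ?thesis .
qed

section \<open>The inequality on product spaces\<close>

text \<open>For each of the \<open>2 ^ card I\<close> selections \<open>z\<close>, the point \<open>mix I z \<omega>\<close> has the given law, so the left
side times \<open>2 ^ card I\<close> is the integral of a sum over the cube of all \<open>z\<close>. For fixed
\<open>\<omega>\<close>, a function that depends on the coordinates in \<open>K\<close> becomes a function on the cube that depends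
on the coordinates in \<open>K\<close>, and \<open>reimer_cube_functional\<close> bounds the sum. The resulting products
involve opposite selections, which are independent, and so integrate to the right side.\<close>
lemma reimer_functional_two:
  fixes f :: "'b \<Rightarrow> ('i \<Rightarrow> 'a) \<Rightarrow> ennreal" and g :: "'c \<Rightarrow> ('i \<Rightarrow> 'a) \<Rightarrow> ennreal"
  assumes I: "finite I" and M: "\<And>i. i \<in> I \<Longrightarrow> prob_space (M i)"
    and cnt: "countable A" "countable B"
    and f: "\<And>\<alpha>. \<alpha> \<in> A \<Longrightarrow> f \<alpha> \<in> borel_measurable (Pi\<^sub>M I M)"
    and g: "\<And>\<beta>. \<beta> \<in> B \<Longrightarrow> g \<beta> \<in> borel_measurable (Pi\<^sub>M I M)"
    and K: "\<And>\<alpha>. \<alpha> \<in> A \<Longrightarrow> depends_on (space (Pi\<^sub>M I M)) (f \<alpha>) (K \<alpha>)"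
    and L: "\<And>\<beta>. \<beta> \<in> B \<Longrightarrow> depends_on (space (Pi\<^sub>M I M)) (g \<beta>) (L \<beta>)"
  shows "(\<integral>\<^sup>+x. (SUP (\<alpha>, \<beta>)\<in>{(\<alpha>, \<beta>) \<in> A \<times> B. K \<alpha> \<inter> L \<beta> = {}}. f \<alpha> x * g \<beta> x) \<partial>Pi\<^sub>M I M)
       \<le> (\<integral>\<^sup>+x. (SUP \<alpha>\<in>A. f \<alpha> x) \<partial>Pi\<^sub>M I M) * (\<integral>\<^sup>+x. (SUP \<beta>\<in>B. g \<beta> x) \<partial>Pi\<^sub>M I M)"
proof -
  let ?D = "{(\<alpha>, \<beta>) \<in> A \<times> B. K \<alpha> \<inter> L \<beta> = {}}"
  let ?N = "Pi\<^sub>M (I \<times> (UNIV :: bool set)) (\<lambda>p. M (fst p))"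
  define W where "W x = (SUP (\<alpha>, \<beta>)\<in>?D. f \<alpha> x * g \<beta> x)" for x
  define F where "F x = (SUP \<alpha>\<in>A. f \<alpha> x)" for x
  define G where "G x = (SUP \<beta>\<in>B. g \<beta> x)" for x
  have "countable ?D" using cnt by (auto intro: countable_subset[of _ "A \<times> B"])
  moreover have "(\<lambda>x. f \<alpha> x * g \<beta> x) \<in> borel_measurable (Pi\<^sub>M I M)" if "(\<alpha>, \<beta>) \<in> ?D" for \<alpha> \<beta>
    using that f[of \<alpha>] g[of \<beta>] by (intro borel_measurable_times_ennreal) simp_all
  ultimately have W_meas: "W \<in> borel_measurable (Pi\<^sub>M I M)"
    unfolding W_def by (intro borel_measurable_SUP) auto
  have F_meas: "F \<in> borel_measurable (Pi\<^sub>M I M)" and G_meas: "G \<in> borel_measurable (Pi\<^sub>M I M)"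
    unfolding F_def G_def using cnt f g by (auto intro!: borel_measurable_SUP)
  have W_mix: "(\<integral>\<^sup>+\<omega>. W (mix I z \<omega>) \<partial>?N) = (\<integral>\<^sup>+x. W x \<partial>Pi\<^sub>M I M)" for z
    by (rule nn_integral_mix[OF M W_meas])
  have FG_mix: "(\<integral>\<^sup>+\<omega>. F (mix I z \<omega>) * G (mix I (I - z) \<omega>) \<partial>?N)
      = (\<integral>\<^sup>+x. F x \<partial>Pi\<^sub>M I M) * (\<integral>\<^sup>+x. G x \<partial>Pi\<^sub>M I M)" for z
    by (rule nn_integral_mix_mult[OF M F_meas G_meas])
  note meas = measurable_compose[OF measurable_mix W_meas]
    measurable_compose[OF measurable_mix F_meas] measurable_compose[OF measurable_mix G_meas]
  have "2 ^ card I * (\<integral>\<^sup>+x. W x \<partial>Pi\<^sub>M I M) = (\<Sum>z\<in>Pow I. \<integral>\<^sup>+\<omega>. W (mix I z \<omega>) \<partial>?N)"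
    using I by (simp only: W_mix sum_constant card_Pow of_nat_power of_nat_numeral)
  also have "\<dots> = (\<integral>\<^sup>+\<omega>. (\<Sum>z\<in>Pow I. W (mix I z \<omega>)) \<partial>?N)"
    by (rule nn_integral_sum[symmetric]) (rule meas(1))
  also have "\<dots> \<le> (\<integral>\<^sup>+\<omega>. (\<Sum>z\<in>Pow I. F (mix I z \<omega>) * G (mix I (I - z) \<omega>)) \<partial>?N)"
  proof (rule nn_integral_mono)
    fix \<omega> assume \<omega>: "\<omega> \<in> space ?N"
    have sp: "mix I z \<omega> \<in> space (Pi\<^sub>M I M)" for z
      using measurable_space[OF measurable_mix \<omega>] .
    show "(\<Sum>z\<in>Pow I. W (mix I z \<omega>)) \<le> (\<Sum>z\<in>Pow I. F (mix I z \<omega>) * G (mix I (I - z) \<omega>))"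
      unfolding W_def F_def G_def
    proof (rule reimer_cube_functional[OF I cnt])
      fix \<alpha> z z' assume \<alpha>: "\<alpha> \<in> A" and eq: "z \<inter> K \<alpha> = z' \<inter> K \<alpha>"
      show "f \<alpha> (mix I z \<omega>) = f \<alpha> (mix I z' \<omega>)"
        by (rule depends_onD[OF K[OF \<alpha>] sp sp]) (rule mix_cong[OF eq])
    next
      fix \<beta> z z' assume \<beta>: "\<beta> \<in> B" and eq: "z \<inter> L \<beta> = z' \<inter> L \<beta>"
      show "g \<beta> (mix I z \<omega>) = g \<beta> (mix I z' \<omega>)"
        by (rule depends_onD[OF L[OF \<beta>] sp sp]) (rule mix_cong[OF eq])
    qed
  qed
  also have "\<dots> = (\<Sum>z\<in>Pow I. \<integral>\<^sup>+\<omega>. F (mix I z \<omega>) * G (mix I (I - z) \<omega>) \<partial>?N)"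
    by (rule nn_integral_sum) (rule borel_measurable_times_ennreal[OF meas(2,3)])
  also have "\<dots> = 2 ^ card I * ((\<integral>\<^sup>+x. F x \<partial>Pi\<^sub>M I M) * (\<integral>\<^sup>+x. G x \<partial>Pi\<^sub>M I M))"
    using I by (simp only: FG_mix sum_constant card_Pow of_nat_power of_nat_numeral)
  finally have "2 ^ card I * (\<integral>\<^sup>+x. W x \<partial>Pi\<^sub>M I M)
      \<le> 2 ^ card I * ((\<integral>\<^sup>+x. F x \<partial>Pi\<^sub>M I M) * (\<integral>\<^sup>+x. G x \<partial>Pi\<^sub>M I M))" .
  moreover have "(2 ^ card I :: ennreal) \<noteq> 0" "(2 ^ card I :: ennreal) \<noteq> \<top>"
    by (simp_all add: power_eq_top_ennreal)
  ultimately have "(\<integral>\<^sup>+x. W x \<partial>Pi\<^sub>M I M)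
      \<le> (\<integral>\<^sup>+x. F x \<partial>Pi\<^sub>M I M) * (\<integral>\<^sup>+x. G x \<partial>Pi\<^sub>M I M)"
    using ennreal_mult_le_mult_iff by blast
  then show ?thesis unfolding W_def F_def G_def .
qed

text \<open>Induction on the number of factors: the product over the first \<open>m\<close> families is one family, indexed by
the admissible choices for them, whose members depend on the union of the chosen sets; the last
family is paired with it by \<open>reimer_functional_two\<close>.\<close>
lemma reimer_functional:
  fixes f :: "nat \<Rightarrow> 'b \<Rightarrow> (nat \<Rightarrow> 'a) \<Rightarrow> ennreal"
  assumes I: "finite I" and M: "\<And>i. i \<in> I \<Longrightarrow> prob_space (M i)"
    and "\<And>i. i \<in> {1..m} \<Longrightarrow> countable (A i)"
    and "\<And>i \<alpha>. i \<in> {1..m} \<Longrightarrow> \<alpha> \<in> A i \<Longrightarrow> f i \<alpha> \<in> borel_measurable (Pi\<^sub>M I M)"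
    and "\<And>i \<alpha>. i \<in> {1..m} \<Longrightarrow> \<alpha> \<in> A i \<Longrightarrow> depends_on (space (Pi\<^sub>M I M)) (f i \<alpha>) (K i \<alpha>)"
  shows "(\<integral>\<^sup>+x. (SUP \<alpha>\<in>disjoint_choices m A K. \<Prod>i=1..m. f i (\<alpha> i) x) \<partial>Pi\<^sub>M I M)
       \<le> (\<Prod>i=1..m. \<integral>\<^sup>+x. (SUP \<alpha>\<in>A i. f i \<alpha> x) \<partial>Pi\<^sub>M I M)"
  using assms(3-)
proof (induction m)
  case 0
  interpret prob_space "Pi\<^sub>M I M" using M by (rule prob_space_PiM)
  have "(\<integral>\<^sup>+x. (SUP \<alpha>\<in>disjoint_choices 0 A K. 1) \<partial>Pi\<^sub>M I M) \<le> (\<integral>\<^sup>+x. 1 \<partial>Pi\<^sub>M I M)"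
    by (intro nn_integral_mono SUP_least) simp
  then show ?case by (simp add: emeasure_space_1)
next
  case (Suc m)
  let ?D = "disjoint_choices m A K"
  define g where "g \<alpha> x = (\<Prod>i=1..m. f i (\<alpha> i) x)" for \<alpha> x
  define L where "L \<alpha> = (\<Union>i\<in>{1..m}. K i (\<alpha> i))" for \<alpha>
  have D: "\<alpha> i \<in> A i" if "\<alpha> \<in> ?D" "i \<in> {1..m}" for \<alpha> i
    using that by (auto simp: disjoint_choices_def)
  have "countable (Pi\<^sub>E {1..m} A)" using Suc.prems(1) by (intro countable_PiE) auto
  then have cnt: "countable ?D" by (rule countable_subset[rotated]) (auto simp: disjoint_choices_def)
  have "(\<integral>\<^sup>+x. (SUP \<alpha>\<in>disjoint_choices (Suc m) A K. \<Prod>i=1..Suc m. f i (\<alpha> i) x) \<partial>Pi\<^sub>M I M)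
      \<le> (\<integral>\<^sup>+x. (SUP (\<alpha>, \<beta>)\<in>{(\<alpha>, \<beta>) \<in> ?D \<times> A (Suc m). L \<alpha> \<inter> K (Suc m) \<beta> = {}}.
            g \<alpha> x * f (Suc m) \<beta> x) \<partial>Pi\<^sub>M I M)"
  proof (intro nn_integral_mono SUP_least)
    fix x \<alpha> assume \<alpha>: "\<alpha> \<in> disjoint_choices (Suc m) A K"
    let ?\<alpha> = "restrict \<alpha> {1..m}"
    have "?\<alpha> \<in> ?D" "\<alpha> (Suc m) \<in> A (Suc m)"
      using \<alpha> by (auto simp: disjoint_choices_def PiE_def Pi_def)
    moreover have "L ?\<alpha> \<inter> K (Suc m) (\<alpha> (Suc m)) = {}"
    proof -
      have "K i (\<alpha> i) \<inter> K (Suc m) (\<alpha> (Suc m)) = {}" if "i \<in> {1..m}" for i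
        using \<alpha> that unfolding disjoint_choices_def by simp
      moreover have "L ?\<alpha> = (\<Union>i\<in>{1..m}. K i (\<alpha> i))" unfolding L_def by simp
      ultimately show ?thesis by blast
    qed
    moreover have "(\<Prod>i=1..Suc m. f i (\<alpha> i) x) = g ?\<alpha> x * f (Suc m) (\<alpha> (Suc m)) x"
      by (simp add: g_def)
    ultimately show "(\<Prod>i=1..Suc m. f i (\<alpha> i) x)
      \<le> (SUP (\<alpha>, \<beta>)\<in>{(\<alpha>, \<beta>) \<in> ?D \<times> A (Suc m). L \<alpha> \<inter> K (Suc m) \<beta> = {}}. g \<alpha> x * f (Suc m) \<beta> x)"
      by (intro SUP_upper2[of "(?\<alpha>, \<alpha> (Suc m))"]) auto
  qed
  also have "\<dots> \<le> (\<integral>\<^sup>+x. (SUP \<alpha>\<in>?D. g \<alpha> x) \<partial>Pi\<^sub>M I M) * (\<integral>\<^sup>+x. (SUP \<beta>\<in>A (Suc m). f (Suc m) \<beta> x) \<partial>Pi\<^sub>M I M)"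
  proof (rule reimer_functional_two[OF I M cnt])
    fix \<alpha> assume \<alpha>: "\<alpha> \<in> ?D"
    show "g \<alpha> \<in> borel_measurable (Pi\<^sub>M I M)"
      unfolding g_def using D[OF \<alpha>] Suc.prems(2) by (intro borel_measurable_prod_ennreal) auto
    have "f i (\<alpha> i) x = f i (\<alpha> i) y"
      if i: "i \<in> {1..m}" and xy: "x \<in> space (Pi\<^sub>M I M)" "y \<in> space (Pi\<^sub>M I M)" "\<forall>j\<in>L \<alpha>. x j = y j" for i x y
    proof (rule depends_onD[OF _ xy(1,2)])
      show "depends_on (space (Pi\<^sub>M I M)) (f i (\<alpha> i)) (K i (\<alpha> i))"
        using i D[OF \<alpha> i] by (intro Suc.prems(3)) auto
    qed (use i xy(3) in \<open>auto simp: L_def\<close>)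
    then show "depends_on (space (Pi\<^sub>M I M)) (g \<alpha>) (L \<alpha>)"
      unfolding depends_on_def g_def by (intro ballI impI prod.cong refl) blast
  qed (use Suc.prems in auto)
  also have "\<dots> \<le> (\<Prod>i=1..m. \<integral>\<^sup>+x. (SUP \<alpha>\<in>A i. f i \<alpha> x) \<partial>Pi\<^sub>M I M)
      * (\<integral>\<^sup>+x. (SUP \<beta>\<in>A (Suc m). f (Suc m) \<beta> x) \<partial>Pi\<^sub>M I M)"
    unfolding g_def using Suc.prems by (intro mult_right_mono Suc.IH) auto
  finally show ?case by simp
qed

section \<open>Random vectors with independent coordinates\<close>

theorem theorem1p3:
  fixes n m :: nat
    and M :: "nat \<Rightarrow> 'a measure"
    and P :: "'w measure"
    and X :: "'w \<Rightarrow> nat \<Rightarrow> 'a"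
    and A :: "nat \<Rightarrow> 'b set"
    and f :: "nat \<Rightarrow> 'b \<Rightarrow> (nat \<Rightarrow> 'a) \<Rightarrow> real"
    and K :: "nat \<Rightarrow> 'b \<Rightarrow> nat set"
  assumes "n \<ge> 1" and "m \<ge> 1"
    and "prob_space P"
    and "X \<in> measurable P (Pi\<^sub>M {1..n} M)"
    and "prob_space.indep_vars P M (\<lambda>i \<omega>. X \<omega> i) {1..n}"
    and "\<And>i. i \<in> {1..m} \<Longrightarrow> countable (A i)"
    and "\<And>i \<alpha>. i \<in> {1..m} \<Longrightarrow> \<alpha> \<in> A i \<Longrightarrow> f i \<alpha> \<in> borel_measurable (Pi\<^sub>M {1..n} M)"
    and "\<And>i \<alpha> x. i \<in> {1..m} \<Longrightarrow> \<alpha> \<in> A i \<Longrightarrow> x \<in> space (Pi\<^sub>M {1..n} M) \<Longrightarrow> f i \<alpha> x \<ge> 0"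
    and "\<And>i \<alpha>. i \<in> {1..m} \<Longrightarrow> \<alpha> \<in> A i \<Longrightarrow> K i \<alpha> \<subseteq> {1..n}"
    and "\<And>i \<alpha>. i \<in> {1..m} \<Longrightarrow> \<alpha> \<in> A i \<Longrightarrow> depends_on (space (Pi\<^sub>M {1..n} M)) (f i \<alpha>) (K i \<alpha>)"
  shows "(\<integral>\<^sup>+ \<omega>. (SUP \<alpha>\<in>disjoint_choices m A K. ennreal (\<Prod>i=1..m. f i (\<alpha> i) (X \<omega>))) \<partial>P)
       \<le> (\<Prod>i=1..m. \<integral>\<^sup>+ \<omega>. (SUP \<alpha>\<in>A i. ennreal (f i \<alpha> (X \<omega>))) \<partial>P)"
proof -
  interpret prob_space P by fact
  let ?I = "{1..n}"
  define D where "D i = distr P (M i) (\<lambda>\<omega>. X \<omega> i)" for i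
  have X: "X \<in> measurable P (Pi\<^sub>M ?I M)" by fact
  have Xi: "(\<lambda>\<omega>. X \<omega> i) \<in> measurable P (M i)" if "i \<in> ?I" for i
    using measurable_compose[OF X measurable_component_singleton[OF that]] .
  have D: "prob_space (D i)" if "i \<in> ?I" for i
    unfolding D_def using Xi[OF that] by (rule prob_space_distr)
  have setsD: "sets (Pi\<^sub>M ?I D) = sets (Pi\<^sub>M ?I M)"
    by (intro sets_PiM_cong) (auto simp: D_def)
  note spD = sets_eq_imp_space_eq[OF setsD]
  have "distr P (Pi\<^sub>M ?I M) (\<lambda>\<omega>. \<lambda>i\<in>?I. X \<omega> i) = Pi\<^sub>M ?I D"
    using indep_vars_iff_distr_eq_PiM'[of ?I "\<lambda>i \<omega>. X \<omega> i" M] assms(1,5) Xi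
    unfolding D_def by auto
  moreover have "distr P (Pi\<^sub>M ?I M) (\<lambda>\<omega>. \<lambda>i\<in>?I. X \<omega> i) = distr P (Pi\<^sub>M ?I M) X"
  proof (rule distr_cong)
    fix \<omega> assume "\<omega> \<in> space P"
    from measurable_space[OF X this] show "(\<lambda>i\<in>?I. X \<omega> i) = X \<omega>"
      unfolding space_PiM by (rule PiE_restrict)
  qed auto
  \<comment> \<open>The law of \<open>X\<close> is the product of its marginals, which reduces the claim to product spaces.\<close>
  ultimately have law: "Pi\<^sub>M ?I D = distr P (Pi\<^sub>M ?I M) X" by simp
  have transfer: "\<And>h. h \<in> borel_measurable (Pi\<^sub>M ?I M) \<Longrightarrow> (\<integral>\<^sup>+ \<omega>. h (X \<omega>) \<partial>P) = (\<integral>\<^sup>+ x. h x \<partial>Pi\<^sub>M ?I D)"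
    unfolding law by (rule nn_integral_distr[OF X, symmetric]) (simp only: measurable_distr_eq1)
  have "countable (Pi\<^sub>E {1..m} A)" using assms(6) by (intro countable_PiE) auto
  then have cnt: "countable (disjoint_choices m A K)"
    by (rule countable_subset[rotated]) (auto simp: disjoint_choices_def)
  have meas: "(\<lambda>x. ennreal (f i \<alpha> x)) \<in> borel_measurable (Pi\<^sub>M ?I M)" if "i \<in> {1..m}" "\<alpha> \<in> A i" for i \<alpha>
    using assms(7)[OF that] by simp
  have ch: "\<alpha> i \<in> A i" if "\<alpha> \<in> disjoint_choices m A K" "i \<in> {1..m}" for \<alpha> i
    using that by (auto simp: disjoint_choices_def)
  have "(\<integral>\<^sup>+ \<omega>. (SUP \<alpha>\<in>disjoint_choices m A K. ennreal (\<Prod>i=1..m. f i (\<alpha> i) (X \<omega>))) \<partial>P)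
      = (\<integral>\<^sup>+ \<omega>. (SUP \<alpha>\<in>disjoint_choices m A K. \<Prod>i=1..m. ennreal (f i (\<alpha> i) (X \<omega>))) \<partial>P)"
    using measurable_space[OF X] ch assms(8)
    by (intro nn_integral_cong SUP_cong refl prod_ennreal[symmetric]) auto
  also have "\<dots> = (\<integral>\<^sup>+ x. (SUP \<alpha>\<in>disjoint_choices m A K. \<Prod>i=1..m. ennreal (f i (\<alpha> i) x)) \<partial>Pi\<^sub>M ?I D)"
    using cnt ch meas
    by (intro transfer
        borel_measurable_SUP borel_measurable_prod_ennreal) auto
  also have "\<dots> \<le> (\<Prod>i=1..m. \<integral>\<^sup>+ x. (SUP \<alpha>\<in>A i. ennreal (f i \<alpha> x)) \<partial>Pi\<^sub>M ?I D)"
  proof (rule reimer_functional[OF _ D])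
    fix i \<alpha> assume i: "i \<in> {1..m}" "\<alpha> \<in> A i"
    show "(\<lambda>x. ennreal (f i \<alpha> x)) \<in> borel_measurable (Pi\<^sub>M ?I D)"
      unfolding measurable_cong_sets[OF setsD refl] by (rule meas[OF i])
    show "depends_on (space (Pi\<^sub>M ?I D)) (\<lambda>x. ennreal (f i \<alpha> x)) (K i \<alpha>)"
      using depends_onD[OF assms(10)[OF i]] unfolding spD depends_on_def[where f = "\<lambda>x. ennreal (f i \<alpha> x)"]
      by (intro ballI impI arg_cong[where f = ennreal]) blast
  qed (use assms(6) in auto)
  also have "\<dots> = (\<Prod>i=1..m. \<integral>\<^sup>+ \<omega>. (SUP \<alpha>\<in>A i. ennreal (f i \<alpha> (X \<omega>))) \<partial>P)"
    using assms(6) meas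
    by (intro prod.cong refl transfer[symmetric] borel_measurable_SUP) auto
  finally show ?thesis .
qed

end
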